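(* Let $(\Phi,\mathbb P)$ be a stationary point process on $\mathbb R^d$ with finite and positive intensity and Palm probability $\mathbb P_\Phi$, and let $F$ be a (flow-adapted) point-shift. Then the distribution of the point foil of $\Phi$ with respect to $F$ is left invariant by all bijective point-shifts preserving the $F$-foliation: if $H$ is a (flow-adapted) point-shift with point-map $h$ which is almost surely bijective on $\Phi$ and maps each $F$-foil onto itself, then, under $\mathbb P_\Phi$, the counting measure $\theta_{h(\Phi)}\Psi(L_0)$ has the same distribution as $\Psi(L_0)$.
   Context: $\mathbf N$ is the space of locally finite simple counting measures on $\mathbb R^d$ with the $\sigma$-field generated by $\phi\mapsto\phi(B)$, $B$ Borel; $\phi\in\mathbf N$ is identified with its support. $\mathbf N^0\subset\mathbf N$ is the set of $\phi$ with an atom at $0$. The translation flow is $(\theta_t\phi)(B)=\phi(B+t)$ and $\theta_t x=x-t$. The group $\mathbb R^d$ also acts on the probability space by $\theta_t$; a stationary point process is a pair $(\Phi,\mathbb P)$ where $\mathbb P$ is invariant under all $\theta_t$ and $\Phi:\Omega\to\mathbf N$ is measurable with $\Phi(\theta_t\omega)=\theta_t\Phi(\omega)$. Its Palm probability is $\mathbb P_\Phi$ (under which $0\in\Phi$ a.s.). A point-map is a measurable $f:\mathbf N^0\to\mathbb R^d$ with $f(\phi)\in\phi$; the associated (flow-adapted) point-shift is $F_\phi(x)=f(\theta_x\phi)+x$ for $x\in\phi$. All point-shifts are of this form. The foil of $x\in\phi$ is its class for the equivalence relation $x\sim_F y\iff\exists n\in\mathbb N,\ F_\phi^n(x)=F_\phi^n(y)$.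 $L_0$ denotes the foil of $0$ under $\mathbb P_\Phi$, and $\Psi(L_0)$ is the counting measure with support $L_0$; this random counting measure under $\mathbb P_\Phi$ is called the point foil. *)

theory Defs
  imports "HOL-Probability.Probability"
begin

definition locally_finite_set :: "'a::euclidean_space set \<Rightarrow> bool" where
  "locally_finite_set S \<longleftrightarrow> (\<forall>B. bounded B \<longrightarrow> finite (S \<inter> B))"

text \<open>The counting measure with support \<open>S\<close>, as a Borel measure: \<open>B \<mapsto> #(S \<inter> B)\<close>.\<close>

definition counting_measure :: "'a::euclidean_space set \<Rightarrow> 'a measure" where
  "counting_measure S = distr (count_space S) borel (\<lambda>x. x)"

definition simple_counting_measures :: "'a::euclidean_space measure set" where
  "simple_counting_measures = counting_measure ` {S. locally_finite_set S}"

definition supp :: "'a::euclidean_space measure \<Rightarrow> 'a set" where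
  "supp \<phi> = {x. emeasure \<phi> {x} \<noteq> 0}"

text \<open>The space \<open>\<^bold>N\<close> with the \<open>\<sigma>\<close>-algebra generated by \<open>\<phi> \<mapsto> \<phi>(B)\<close>, \<open>B\<close> Borel.\<close>

definition config_space :: "'a::euclidean_space measure measure" where
  "config_space =
    (SUP B \<in> sets borel. vimage_algebra simple_counting_measures (\<lambda>\<phi>. emeasure \<phi> B) borel)"

definition config_space0 :: "'a::euclidean_space measure measure" where
  "config_space0 = restrict_space config_space {\<phi>. 0 \<in> supp \<phi>}"

text \<open>\<open>(\<theta>\<^sub>t \<phi>)(B) = \<phi>(B + t)\<close>, the image of \<open>\<phi>\<close> under \<open>x \<mapsto> x - t\<close>.\<close>

definition translate :: "'a::euclidean_space \<Rightarrow> 'a measure \<Rightarrow> 'a measure" where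
  "translate t \<phi> = distr \<phi> borel (\<lambda>x. x - t)"

text \<open>Joint measurability in \<open>(t, \<omega>)\<close> is part of the notion of a flow: without it the integral
  defining the Palm probability need not make sense.\<close>

definition measurable_flow :: "'w measure \<Rightarrow> ('a::euclidean_space \<Rightarrow> 'w \<Rightarrow> 'w) \<Rightarrow> bool" where
  "measurable_flow M \<theta> \<longleftrightarrow>
    (\<lambda>(t, \<omega>). \<theta> t \<omega>) \<in> borel \<Otimes>\<^sub>M M \<rightarrow>\<^sub>M M \<and>
    (\<forall>\<omega>\<in>space M. \<theta> 0 \<omega> = \<omega>) \<and>
    (\<forall>\<omega>\<in>space M. \<forall>s t. \<theta> s (\<theta> t \<omega>) = \<theta> (s + t) \<omega>)"

definition stationary_point_process ::
  "'w measure \<Rightarrow> ('a::euclidean_space \<Rightarrow> 'w \<Rightarrow> 'w) \<Rightarrow> ('w \<Rightarrow> 'a measure) \<Rightarrow> bool" where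
  "stationary_point_process M \<theta> \<Phi> \<longleftrightarrow>
    prob_space M \<and> measurable_flow M \<theta> \<and> (\<forall>t. distr M M (\<theta> t) = M) \<and>
    \<Phi> \<in> M \<rightarrow>\<^sub>M config_space \<and>
    (\<forall>\<omega>\<in>space M. \<forall>t. \<Phi> (\<theta> t \<omega>) = translate t (\<Phi> \<omega>))"

text \<open>Intensity and Palm probability are normalised with the unit cube; by stationarity any Borel
  set of Lebesgue measure 1 gives the same values. The Palm probability (on the original space) is
  \<open>A \<mapsto> \<lambda>\<^sup>-\<^sup>1 E (\<integral>\<^sub>[\<^sub>0\<^sub>,\<^sub>1\<^sub>]\<^sup>d 1\<^sub>A(\<theta>\<^sub>x \<omega>) \<Phi>(\<omega>)(dx))\<close>.\<close>

definition intensity :: "'w measure \<Rightarrow> ('w \<Rightarrow> 'a::euclidean_space measure) \<Rightarrow> ennreal" where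
  "intensity M \<Phi> = (\<integral>\<^sup>+\<omega>. emeasure (\<Phi> \<omega>) (cbox 0 One) \<partial>M)"

definition palm ::
  "'w measure \<Rightarrow> ('a::euclidean_space \<Rightarrow> 'w \<Rightarrow> 'w) \<Rightarrow> ('w \<Rightarrow> 'a measure) \<Rightarrow> 'w measure" where
  "palm M \<theta> \<Phi> = measure_of (space M) (sets M)
    (\<lambda>A. (\<integral>\<^sup>+\<omega>. (\<integral>\<^sup>+x\<in>cbox 0 One. indicator A (\<theta> x \<omega>) \<partial>\<Phi> \<omega>) \<partial>M) / intensity M \<Phi>)"

text \<open>Point-maps are total functions here; their values outside \<open>\<^bold>N\<^sup>0\<close> are irrelevant.\<close>

definition point_map :: "('a::euclidean_space measure \<Rightarrow> 'a) \<Rightarrow> bool" where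
  "point_map f \<longleftrightarrow>
    f \<in> config_space0 \<rightarrow>\<^sub>M borel \<and> (\<forall>\<phi>\<in>space config_space0. f \<phi> \<in> supp \<phi>)"

definition point_shift ::
  "('a::euclidean_space measure \<Rightarrow> 'a) \<Rightarrow> 'a measure \<Rightarrow> 'a \<Rightarrow> 'a" where
  "point_shift f \<phi> x = f (translate x \<phi>) + x"

definition foil_rel ::
  "('a::euclidean_space measure \<Rightarrow> 'a) \<Rightarrow> 'a measure \<Rightarrow> ('a \<times> 'a) set" where
  "foil_rel f \<phi> = {(x, y). x \<in> supp \<phi> \<and> y \<in> supp \<phi> \<and>
    (\<exists>n. (point_shift f \<phi> ^^ n) x = (point_shift f \<phi> ^^ n) y)}"

text \<open>The foil of \<open>x\<close> is empty if \<open>x\<close> is not a point of \<open>\<phi>\<close>.\<close>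

definition foil :: "('a::euclidean_space measure \<Rightarrow> 'a) \<Rightarrow> 'a measure \<Rightarrow> 'a \<Rightarrow> 'a set" where
  "foil f \<phi> x = foil_rel f \<phi> `` {x}"

definition point_foil ::
  "('a::euclidean_space measure \<Rightarrow> 'a) \<Rightarrow> ('w \<Rightarrow> 'a measure) \<Rightarrow> 'w \<Rightarrow> 'a measure" where
  "point_foil f \<Phi> \<omega> = counting_measure (foil f (\<Phi> \<omega>) 0)"

end

theory Submission
  imports Defs
begin

text \<open>The idea is that \<open>\<theta>\<^bsub>h(\<Phi>)\<^esub> \<Psi>(L\<^sub>0)\<close>, seen from a typical point, is the foil
  seen from its image under the point-shift \<open>H\<close>. Indeed, write \<open>\<Psi>(L\<^sub>0)\<close> as a function \<open>\<Psi>\<close> of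
  the sample point. If \<open>x\<close> is a point of \<open>\<Phi>\<close>, then \<open>\<Psi>(\<theta>\<^sub>x \<omega>)\<close> is the foil of \<open>x\<close> shifted by \<open>x\<close>.
  As \<open>H\<close> maps the foil of \<open>x\<close> onto itself, \<open>H(x)\<close> has the same foil as \<open>x\<close>, so that
  shifting further by \<open>h\<close> turns \<open>\<Psi>(\<theta>\<^sub>x \<omega>)\<close> into \<open>\<Psi>(\<theta>\<^bsub>H(x)\<^esub> \<omega>)\<close>
  (lemma \<open>translate_point_foil_along_shift\<close>).

  Palm expectations are sums over the points in the unit cube \<open>C\<close>. Hence the theorem reduces to
  \<open>E \<Sum>\<^sub>x 1\<^sub>C(x) g(\<theta>\<^bsub>H(x)\<^esub> \<omega>) = E \<Sum>\<^sub>x 1\<^sub>C(x) g(\<theta>\<^sub>x \<omega>)\<close> for \<open>g = 1\<^sub>A \<circ> \<Psi>\<close>. This is the invariance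
  of the Palm probability under bijective point-shifts (lemma \<open>sum_bijective_point_shift\<close>), an
  instance of the mass transport principle. Its proof lets every pair \<open>(x, H(x))\<close> of points be
  counted once for each \<open>s\<close> with \<open>H(x) - s\<close> in \<open>C\<close>, weighted by Lebesgue measure. By
  stationarity the condition \<open>x \<in> C, H(x) - s \<in> C\<close> may be replaced by
  \<open>x + s \<in> C, H(x) \<in> C\<close>, and integrating over \<open>s\<close> again leaves the condition \<open>H(x) \<in> C\<close>. As \<open>H\<close> is a
  bijection, \<open>H(x)\<close> may finally be renamed \<open>x\<close>. Smoothing over \<open>s\<close> works for any Borel set of volume one, in
  particular for the closed cube, whose integer translates overlap and do not tile the space.

  What remains is measurability. Everything there follows from one fact: a sum over the points of a
  configuration of a jointly measurable function depends measurably on the parameters (lemma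
  \<open>measurable_kernel_nn_integral\<close>). It yields in turn joint measurability of translation, of the
  iterates of a point-shift and of the foil. Since a point-map is measurable on \<open>\<^bold>N\<^sup>0\<close> only, it is
  first replaced by its extension by \<open>0\<close> to all of \<open>\<^bold>N\<close>, which has the same iterates on the points
  of a configuration.\<close>

section \<open>Counting measures of locally finite sets\<close>

lemma counting_measure_simps [simp]:
  "sets (counting_measure S) = sets borel" "space (counting_measure S) = UNIV"
  by (simp_all add: counting_measure_def)

lemma emeasure_counting_measure:
  assumes "B \<in> sets borel"
  shows "emeasure (counting_measure S) B = emeasure (count_space S) (S \<inter> B)"
  using assms unfolding counting_measure_def
  by (subst emeasure_distr) (auto simp: Int_commute)

lemma nn_integral_counting_measure:
  assumes "u \<in> borel_measurable borel"
  shows "(\<integral>\<^sup>+x. u x \<partial>counting_measure S) = (\<integral>\<^sup>+x. u x \<partial>count_space S)"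
  using assms unfolding counting_measure_def by (subst nn_integral_distr) auto

lemma supp_counting_measure [simp]: "supp (counting_measure S) = S"
proof -
  have "emeasure (count_space S) (S \<inter> {x}) = (if x \<in> S then 1 else 0)" for x
    by (subst emeasure_count_space) auto
  then show ?thesis
    unfolding supp_def by (simp add: emeasure_counting_measure)
qed

lemma locally_finite_set_countable:
  assumes "locally_finite_set S"
  shows "countable S"
proof -
  have "S = (\<Union>n. S \<inter> cball 0 (real n))"
    using real_arch_simple by auto
  moreover have "finite (S \<inter> cball 0 (real n))" for n
    using assms unfolding locally_finite_set_def by simp
  ultimately show ?thesis
    by (metis countable_UN countable_finite countableI_type)
qed

lemma simple_counting_measuresE:
  assumes "\<phi> \<in> simple_counting_measures"
  shows "\<phi> = counting_measure (supp \<phi>)" "locally_finite_set (supp \<phi>)"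
  using assms by (auto simp: simple_counting_measures_def)

lemma counting_measure_in_simple:
  "locally_finite_set S \<Longrightarrow> counting_measure S \<in> simple_counting_measures"
  by (auto simp: simple_counting_measures_def)

lemma simple_counting_measures_sets:
  "\<phi> \<in> simple_counting_measures \<Longrightarrow> sets \<phi> = sets borel"
  by (auto simp: simple_counting_measures_def)

lemma nn_integral_simple_counting_measure:
  assumes "\<phi> \<in> simple_counting_measures" "u \<in> borel_measurable borel"
  shows "(\<integral>\<^sup>+x. u x \<partial>\<phi>) = (\<integral>\<^sup>+x. u x \<partial>count_space (supp \<phi>))"
  using nn_integral_counting_measure[OF assms(2)] simple_counting_measuresE(1)[OF assms(1)]
  by metis

lemma emeasure_bounded_finite:
  assumes "\<phi> \<in> simple_counting_measures" "bounded B" "B \<in> sets borel"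
  shows "emeasure \<phi> B < \<infinity>"
proof -
  have "finite (supp \<phi> \<inter> B)"
    using simple_counting_measuresE(2)[OF assms(1)] assms(2) by (simp add: locally_finite_set_def)
  then have "emeasure (counting_measure (supp \<phi>)) B < \<infinity>"
    by (simp add: emeasure_counting_measure assms(3) emeasure_count_space of_nat_less_top)
  with simple_counting_measuresE(1)[OF assms(1)] show ?thesis by simp
qed

section \<open>Sums over the points of a configuration\<close>

lemma space_config_space [simp]: "space config_space = simple_counting_measures"
  unfolding config_space_def by (subst space_Sup_eq_UN) auto

lemma measurable_emeasure_config_space:
  assumes "B \<in> sets borel"
  shows "(\<lambda>\<phi>. emeasure \<phi> B) \<in> borel_measurable config_space"
  unfolding config_space_def
  by (rule measurable_SUP1[OF assms]) (auto intro!: measurable_vimage_algebra1)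

lemma measurable_config_spaceI:
  assumes "\<And>a. a \<in> space N \<Longrightarrow> K a \<in> simple_counting_measures"
    and "\<And>B. B \<in> sets borel \<Longrightarrow> (\<lambda>a. emeasure (K a) B) \<in> borel_measurable N"
  shows "K \<in> N \<rightarrow>\<^sub>M config_space"
  unfolding config_space_def
  by (rule measurable_SUP2) (auto intro!: measurable_vimage_algebra2 assms)

text \<open>Restricting to a bounded set makes all the measures finite, so that complements can be handled by
  subtraction in the Dynkin system argument.\<close>

lemma measurable_kernel_emeasure_bounded:
  assumes K: "K \<in> N \<rightarrow>\<^sub>M config_space" and Q: "Q \<in> sets (N \<Otimes>\<^sub>M borel)"
    and B: "bounded B" "B \<in> sets borel"
  shows "(\<lambda>a. emeasure (K a) (B \<inter> Pair a -` Q)) \<in> borel_measurable N"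
proof -
  have Ka: "K a \<in> simple_counting_measures" if "a \<in> space N" for a
    using measurable_space[OF K that] by simp
  note sets_K = simple_counting_measures_sets[OF Ka]
  have slice [measurable]: "Pair a -` Q \<in> sets borel" if "Q \<in> sets (N \<Otimes>\<^sub>M borel)" for a Q
    using that by (rule sets_Pair1)
  have eval: "(\<lambda>a. emeasure (K a) C) \<in> borel_measurable N" if "C \<in> sets borel" for C
    using measurable_compose[OF K measurable_emeasure_config_space[OF that]] .
  have gen: "sets (N \<Otimes>\<^sub>M borel) = sigma_sets (space N \<times> space borel)
      {A \<times> C |A C. A \<in> sets N \<and> C \<in> sets borel}"
    by (rule sets_pair_measure)
  from Q show ?thesis
    unfolding gen
  proof (induction rule: sigma_sets_induct_disjoint
      [OF Int_stable_pair_measure_generator pair_measure_closed, consumes 1,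
        case_names basic empty compl union])
    case (basic Q)
    then obtain A C where Q: "Q = A \<times> C" "A \<in> sets N" "C \<in> sets borel" by auto
    have "emeasure (K a) (B \<inter> Pair a -` Q) = indicator A a * emeasure (K a) (B \<inter> C)" for a
      unfolding Q(1) by (cases "a \<in> A") auto
    then show ?case using Q(2,3) B(2) by (auto intro!: borel_measurable_times_ennreal eval)
  next
    case empty
    then show ?case by simp
  next
    case (compl Q)
    then have Q: "Q \<in> sets (N \<Otimes>\<^sub>M borel)" by (simp add: gen)
    have eq: "emeasure (K a) (B \<inter> Pair a -` (space N \<times> space borel - Q))
        = emeasure (K a) B - emeasure (K a) (B \<inter> Pair a -` Q)" if a: "a \<in> space N" for a
    proof -
      have "B \<inter> Pair a -` (space N \<times> space borel - Q) = B - B \<inter> Pair a -` Q" using a by auto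
      moreover have "emeasure (K a) (B \<inter> Pair a -` Q) \<le> emeasure (K a) B"
        using B(2) sets_K[OF a] by (intro emeasure_mono) auto
      then have "emeasure (K a) (B \<inter> Pair a -` Q) \<noteq> \<infinity>"
        using emeasure_bounded_finite[OF Ka[OF a] B] by (auto simp: top_unique)
      ultimately show ?thesis
        using B(2) sets_K[OF a] slice[OF Q, of a]
        by (simp add: emeasure_Diff sets.Int)
    qed
    then show ?case
      using compl.IH eval[OF B(2)] by (subst measurable_cong[OF eq]) simp_all
  next
    case (union Q)
    then have Q: "Q i \<in> sets (N \<Otimes>\<^sub>M borel)" for i using gen by auto
    have eq: "emeasure (K a) (B \<inter> Pair a -` (\<Union>i. Q i)) = (\<Sum>i. emeasure (K a) (B \<inter> Pair a -` Q i))"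
      if a: "a \<in> space N" for a
    proof -
      have "disjoint_family (\<lambda>i. B \<inter> Pair a -` Q i)"
        using union.hyps(1) by (auto simp: disjoint_family_on_def)
      moreover have "range (\<lambda>i. B \<inter> Pair a -` Q i) \<subseteq> sets (K a)"
        using slice[OF Q] B(2) sets_K[OF a] by auto
      ultimately have "(\<Sum>i. emeasure (K a) (B \<inter> Pair a -` Q i))
          = emeasure (K a) (\<Union>i. B \<inter> Pair a -` Q i)"
        by (intro suminf_emeasure) auto
      also have "(\<Union>i. B \<inter> Pair a -` Q i) = B \<inter> Pair a -` (\<Union>i. Q i)" by auto
      finally show ?thesis by simp
    qed
    then show ?case
      using union.IH by (subst measurable_cong[OF eq]) simp_all
  qed
qed

text \<open>The locally finite analogue of the measurability of integrals with respect to a probability kernel: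
  the bounded sets of the preceding lemma exhaust the space, and simple functions do the rest.\<close>

lemma measurable_kernel_nn_integral:
  assumes K: "K \<in> N \<rightarrow>\<^sub>M config_space"
    and g: "(\<lambda>(a, y). g a y) \<in> borel_measurable (N \<Otimes>\<^sub>M borel)"
  shows "(\<lambda>a. \<integral>\<^sup>+y. g a y \<partial>K a) \<in> borel_measurable N"
proof -
  have Ka: "K a \<in> simple_counting_measures" if "a \<in> space N" for a
    using measurable_space[OF K that] by simp
  note sets_K [measurable_cong] = simple_counting_measures_sets[OF Ka]
  have cong: "(\<lambda>y. u (a, y)) \<in> borel_measurable (K a)"
    if "u \<in> borel_measurable (N \<Otimes>\<^sub>M borel)" "a \<in> space N" for u :: "_ \<Rightarrow> ennreal" and a
    using that measurable_compose[OF measurable_Pair1'[OF that(2)] that(1)]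
    by (simp add: measurable_cong_sets[OF sets_K refl])
  have "(\<lambda>a. \<integral>\<^sup>+y. (\<lambda>(a, y). g a y) (a, y) \<partial>K a) \<in> borel_measurable N"
    using g
  proof (induction rule: borel_measurable_induct)
    case (cong u v)
    then have eq: "(\<integral>\<^sup>+y. u (a, y) \<partial>K a) = (\<integral>\<^sup>+y. v (a, y) \<partial>K a)" if "a \<in> space N" for a
      using that sets_eq_imp_space_eq[OF sets_K[OF that]]
      by (intro nn_integral_cong) (auto simp: space_pair_measure)
    then show ?case using cong(4) by (subst measurable_cong[OF eq]) simp_all
  next
    case (set Q)
    have sl: "Pair a -` Q \<in> sets borel" for a using set by (rule sets_Pair1)
    have eq: "(\<integral>\<^sup>+y. indicator Q (a, y) \<partial>K a)
        = (SUP n. emeasure (K a) (cball 0 (real n) \<inter> Pair a -` Q))" if a: "a \<in> space N" for a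
    proof -
      have "(\<integral>\<^sup>+y. indicator Q (a, y) \<partial>K a) = (\<integral>\<^sup>+y. indicator (Pair a -` Q) y \<partial>K a)"
        by (intro nn_integral_cong) (auto simp: indicator_def)
      also have "\<dots> = emeasure (K a) (Pair a -` Q)"
        using sl sets_K[OF a] by (intro nn_integral_indicator) auto
      also have "Pair a -` Q = (\<Union>n. cball 0 (real n) \<inter> Pair a -` Q)"
        using real_arch_simple by auto
      also have "emeasure (K a) \<dots> = (SUP n. emeasure (K a) (cball 0 (real n) \<inter> Pair a -` Q))"
        using sl sets_K[OF a] by (intro SUP_emeasure_incseq[symmetric]) (auto simp: incseq_def)
      finally show ?thesis .
    qed
    then show ?case
      using measurable_kernel_emeasure_bounded[OF K set, of "cball 0 (real _)"]
      by (subst measurable_cong[OF eq]) simp_all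
  next
    case (mult u c)
    have eq: "(\<integral>\<^sup>+y. c * u (a, y) \<partial>K a) = c * (\<integral>\<^sup>+y. u (a, y) \<partial>K a)" if "a \<in> space N" for a
      using that cong[OF mult(2)] by (intro nn_integral_cmult) auto
    then show ?case
      using mult(4) by (subst measurable_cong[OF eq]) simp_all
  next
    case (add u v)
    have eq: "(\<integral>\<^sup>+y. v (a, y) + u (a, y) \<partial>K a) = (\<integral>\<^sup>+y. v (a, y) \<partial>K a) + (\<integral>\<^sup>+y. u (a, y) \<partial>K a)"
      if "a \<in> space N" for a
      using that cong add by (intro nn_integral_add) auto
    then show ?case using add by (subst measurable_cong[OF eq]) simp_all
  next
    case (seq U)
    have eq: "(\<integral>\<^sup>+y. (SUP i. U i) (a, y) \<partial>K a) = (SUP i. \<integral>\<^sup>+y. U i (a, y) \<partial>K a)"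
      if "a \<in> space N" for a
      unfolding SUP_apply using that cong seq
      by (intro nn_integral_monotone_convergence_SUP) (auto simp: incseq_def le_fun_def)
    then show ?case using seq by (subst measurable_cong[OF eq]) simp_all
  qed
  then show ?thesis by simp
qed

section \<open>Translations\<close>

lemma translate_counting_measure:
  "translate t (counting_measure S) = counting_measure ((\<lambda>x. x - t) ` S)"
proof -
  have "bij_betw (\<lambda>x. x - t) S ((\<lambda>x. x - t) ` S)"
    by (simp add: bij_betw_def inj_on_def)
  then have "counting_measure ((\<lambda>x. x - t) ` S)
      = distr (distr (count_space S) (count_space ((\<lambda>x. x - t) ` S)) (\<lambda>x. x - t)) borel (\<lambda>x. x)"
    unfolding counting_measure_def by (simp add: distr_bij_count_space)
  also have "\<dots> = translate t (counting_measure S)"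
    unfolding translate_def counting_measure_def
    by (subst distr_distr; (subst distr_distr)?) (auto simp: comp_def)
  finally show ?thesis ..
qed

lemma locally_finite_set_translate:
  assumes "locally_finite_set S"
  shows "locally_finite_set ((\<lambda>x. x - t) ` S)"
  unfolding locally_finite_set_def
proof (intro allI impI)
  fix B :: "'a set" assume "bounded B"
  then have "bounded ((\<lambda>x. t + x) ` B)" by (rule bounded_translation)
  then have "finite ((\<lambda>x. x - t) ` (S \<inter> (\<lambda>x. t + x) ` B))"
    using assms by (simp add: locally_finite_set_def)
  moreover have "(\<lambda>x. x - t) ` S \<inter> B \<subseteq> (\<lambda>x. x - t) ` (S \<inter> (\<lambda>x. t + x) ` B)"
    by (force simp: image_iff)
  ultimately show "finite ((\<lambda>x. x - t) ` S \<inter> B)" by (rule finite_subset[rotated])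
qed

lemma translate_in_simple:
  assumes "\<phi> \<in> simple_counting_measures"
  shows "translate t \<phi> \<in> simple_counting_measures"
  using assms unfolding simple_counting_measures_def
  by (auto simp: translate_counting_measure locally_finite_set_translate)

lemma supp_translate:
  assumes "\<phi> \<in> simple_counting_measures"
  shows "supp (translate t \<phi>) = (\<lambda>x. x - t) ` supp \<phi>"
  using assms unfolding simple_counting_measures_def by (auto simp: translate_counting_measure)

lemma zero_in_supp_translate:
  assumes "\<phi> \<in> simple_counting_measures"
  shows "0 \<in> supp (translate x \<phi>) \<longleftrightarrow> x \<in> supp \<phi>"
  by (auto simp: supp_translate[OF assms])

lemma translate_translate:
  assumes "\<phi> \<in> simple_counting_measures"
  shows "translate s (translate t \<phi>) = translate (s + t) \<phi>"
  using assms unfolding simple_counting_measures_def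
  by (auto simp: translate_counting_measure image_image algebra_simps)

lemma nn_integral_translate:
  assumes "\<phi> \<in> simple_counting_measures" "u \<in> borel_measurable borel"
  shows "(\<integral>\<^sup>+x. u x \<partial>translate t \<phi>) = (\<integral>\<^sup>+x. u (x - t) \<partial>\<phi>)"
  using assms(2) simple_counting_measures_sets[OF assms(1)] unfolding translate_def
  by (intro nn_integral_distr) (auto cong: measurable_cong_sets)

text \<open>Joint measurability in the configuration and the shift: the mass of \<open>B\<close> after a shift by \<open>t\<close> is the
  sum of \<open>1\<^sub>B(y - t)\<close> over the points \<open>y\<close>, a jointly measurable function of \<open>t\<close> and \<open>y\<close>.\<close>

lemma measurable_translate:
  fixes g :: "'b \<Rightarrow> 'a::euclidean_space"
  assumes K: "K \<in> N \<rightarrow>\<^sub>M config_space" and g [measurable]: "g \<in> N \<rightarrow>\<^sub>M borel"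
  shows "(\<lambda>a. translate (g a) (K a)) \<in> N \<rightarrow>\<^sub>M config_space"
proof (rule measurable_config_spaceI)
  fix a assume "a \<in> space N"
  then show "translate (g a) (K a) \<in> simple_counting_measures"
    using measurable_space[OF K] by (simp add: translate_in_simple)
next
  fix B :: "'a set" assume B [measurable]: "B \<in> sets borel"
  have "emeasure (translate (g a) (K a)) B = (\<integral>\<^sup>+y. indicator B (y - g a) \<partial>K a)"
    if "a \<in> space N" for a
  proof -
    have Ka: "K a \<in> simple_counting_measures" using measurable_space[OF K that] by simp
    have "emeasure (translate (g a) (K a)) B = (\<integral>\<^sup>+y. indicator B y \<partial>translate (g a) (K a))"
      using B by (simp add: translate_def)
    then show ?thesis by (simp add: nn_integral_translate[OF Ka])
  qed
  note eq = this
  show "(\<lambda>a. emeasure (translate (g a) (K a)) B) \<in> borel_measurable N"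
    by (subst measurable_cong[OF eq], assumption, rule measurable_kernel_nn_integral[OF K]) measurable
qed

text \<open>The mass of a moving singleton \<open>{g a}\<close> is the sum of \<open>1[y = g a]\<close> over the points \<open>y\<close>, and the diagonal
  is a Borel set.\<close>

lemma measurable_in_supp:
  assumes K: "K \<in> N \<rightarrow>\<^sub>M config_space" and g [measurable]: "g \<in> N \<rightarrow>\<^sub>M borel"
  shows "Measurable.pred N (\<lambda>a. g a \<in> supp (K a))"
proof -
  have "g a \<in> supp (K a) \<longleftrightarrow> (\<integral>\<^sup>+y. (if y = g a then 1 else 0) \<partial>K a) \<noteq> 0" if "a \<in> space N" for a
  proof -
    have Ka: "K a \<in> simple_counting_measures" using measurable_space[OF K that] by simp
    have "(\<integral>\<^sup>+y. (if y = g a then 1 else 0) \<partial>K a) = (\<integral>\<^sup>+y. indicator {g a} y \<partial>K a)"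
      by (intro nn_integral_cong) (auto simp: indicator_def)
    also have "\<dots> = emeasure (K a) {g a}"
      using simple_counting_measures_sets[OF Ka] by (intro nn_integral_indicator) auto
    finally show ?thesis by (simp add: supp_def)
  qed
  note eq = this
  have [measurable]: "(\<lambda>a. \<integral>\<^sup>+y. (if y = g a then 1 else 0) \<partial>K a) \<in> borel_measurable N"
    by (rule measurable_kernel_nn_integral[OF K]) measurable
  show ?thesis
    by (subst measurable_cong[OF eq], assumption) measurable
qed

section \<open>Point-shifts and foils\<close>

text \<open>A point-map carries no information outside \<open>\<^bold>N\<^sup>0\<close>, not even measurability. Prescribing the value \<open>0\<close> there
  gives a function measurable on all of \<open>\<^bold>N\<close>, so that its point-shift can be evaluated at an
  arbitrary point of the space.\<close>

definition extend_map :: "('a::euclidean_space measure \<Rightarrow> 'a) \<Rightarrow> 'a measure \<Rightarrow> 'a" where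
  "extend_map f \<phi> = (if 0 \<in> supp \<phi> then f \<phi> else 0)"

lemma measurable_extend_map:
  assumes "point_map f"
  shows "extend_map f \<in> config_space \<rightarrow>\<^sub>M borel"
proof -
  have "Measurable.pred config_space (\<lambda>\<phi>::'a measure. 0 \<in> supp \<phi>)"
    by (rule measurable_in_supp) auto
  then have "{\<phi> \<in> space config_space. 0 \<in> supp (\<phi> :: 'a measure)} \<in> sets config_space"
    by (rule predE)
  then show ?thesis
    using assms unfolding extend_map_def[abs_def] point_map_def config_space0_def
    by (subst measurable_If_restrict_space_iff) auto
qed

lemma point_shift_extend_map:
  assumes "\<phi> \<in> simple_counting_measures" "x \<in> supp \<phi>"
  shows "point_shift (extend_map f) \<phi> x = point_shift f \<phi> x"
  using zero_in_supp_translate[OF assms(1)] assms(2) by (simp add: point_shift_def extend_map_def)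

lemma point_shift_in_supp:
  assumes "point_map f" "\<phi> \<in> simple_counting_measures" "x \<in> supp \<phi>"
  shows "point_shift f \<phi> x \<in> supp \<phi>"
proof -
  have "translate x \<phi> \<in> space config_space0"
    using assms(2,3) unfolding config_space0_def
    by (simp add: space_restrict_space translate_in_simple zero_in_supp_translate)
  then have "f (translate x \<phi>) \<in> supp (translate x \<phi>)"
    using assms(1) by (simp add: point_map_def)
  then show ?thesis
    by (auto simp: supp_translate[OF assms(2)] point_shift_def)
qed

text \<open>The orbit of a point of \<open>\<phi>\<close> never leaves the support, and there the extension is invisible.\<close>

lemma point_shift_funpow_extend_map:
  assumes "point_map f" "\<phi> \<in> simple_counting_measures" "x \<in> supp \<phi>"
  shows "(point_shift (extend_map f) \<phi> ^^ n) x = (point_shift f \<phi> ^^ n) x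
    \<and> (point_shift f \<phi> ^^ n) x \<in> supp \<phi>"
  by (induction n)
    (simp_all add: assms point_shift_extend_map point_shift_in_supp)

lemma foil_subset_supp: "foil f \<phi> x \<subseteq> supp \<phi>"
  by (auto simp: foil_def foil_rel_def)

lemma foil_extend_map:
  assumes "point_map f" "\<phi> \<in> simple_counting_measures"
  shows "foil (extend_map f) \<phi> x = foil f \<phi> x"
  unfolding foil_def foil_rel_def using point_shift_funpow_extend_map[OF assms] by auto

lemma measurable_point_shift:
  assumes f: "f \<in> config_space \<rightarrow>\<^sub>M borel" and K: "K \<in> N \<rightarrow>\<^sub>M config_space"
    and g [measurable]: "g \<in> N \<rightarrow>\<^sub>M borel"
  shows "(\<lambda>a. point_shift f (K a) (g a)) \<in> N \<rightarrow>\<^sub>M borel"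
proof -
  have [measurable]: "(\<lambda>a. f (translate (g a) (K a))) \<in> N \<rightarrow>\<^sub>M borel"
    using measurable_compose[OF measurable_translate[OF K g] f] .
  show ?thesis unfolding point_shift_def by measurable
qed

lemma measurable_point_shift_funpow:
  assumes f: "f \<in> config_space \<rightarrow>\<^sub>M borel" and K: "K \<in> N \<rightarrow>\<^sub>M config_space"
    and g: "g \<in> N \<rightarrow>\<^sub>M borel"
  shows "(\<lambda>a. (point_shift f (K a) ^^ n) (g a)) \<in> N \<rightarrow>\<^sub>M borel"
  by (induction n) (simp_all add: g measurable_point_shift[OF f K])

text \<open>This expresses the mass of a random subset of the points as a sum over all points, to which the
  measurability of sums applies.\<close>

lemma emeasure_counting_measure_thinning:
  assumes "\<phi> \<in> simple_counting_measures" and [measurable]: "Measurable.pred borel P" "B \<in> sets borel"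
  shows "emeasure (counting_measure {x \<in> supp \<phi>. P x}) B
    = (\<integral>\<^sup>+x. (if P x \<and> x \<in> B then 1 else 0) \<partial>\<phi>)"
proof -
  have "(\<integral>\<^sup>+x. (if P x \<and> x \<in> B then 1 else 0) \<partial>\<phi>)
      = (\<integral>\<^sup>+x. (if P x \<and> x \<in> B then 1 else 0) \<partial>count_space (supp \<phi>))"
    by (rule nn_integral_simple_counting_measure[OF assms(1)]) measurable
  also have "\<dots> = (\<integral>\<^sup>+x. indicator ({x \<in> supp \<phi>. P x} \<inter> B) x \<partial>count_space (supp \<phi>))"
    by (intro nn_integral_cong) (auto simp: indicator_def)
  also have "\<dots> = emeasure (count_space (supp \<phi>)) ({x \<in> supp \<phi>. P x} \<inter> B)"
    by (intro nn_integral_indicator) auto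
  also have "\<dots> = emeasure (count_space {x \<in> supp \<phi>. P x}) ({x \<in> supp \<phi>. P x} \<inter> B)"
    by (subst (1 2) emeasure_count_space) auto
  finally show ?thesis
    by (simp add: emeasure_counting_measure)
qed

lemma locally_finite_subset: "locally_finite_set S \<Longrightarrow> T \<subseteq> S \<Longrightarrow> locally_finite_set T"
  unfolding locally_finite_set_def by (meson Int_mono finite_subset order_refl)

lemma measurable_foil_at_zero:
  fixes f :: "'a::euclidean_space measure \<Rightarrow> 'a"
  assumes f: "point_map f"
  shows "(\<lambda>\<phi>. counting_measure (foil f \<phi> 0)) \<in> config_space \<rightarrow>\<^sub>M config_space"
proof (rule measurable_config_spaceI)
  fix \<phi> :: "'a measure" assume "\<phi> \<in> space config_space"
  then show "counting_measure (foil f \<phi> 0) \<in> simple_counting_measures"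
    using locally_finite_subset[OF simple_counting_measuresE(2) foil_subset_supp]
    by (intro counting_measure_in_simple) auto
next
  fix B :: "'a set" assume B [measurable]: "B \<in> sets borel"
  note it [measurable] = measurable_point_shift_funpow[OF measurable_extend_map[OF f]]
  define P where "P \<phi> y \<longleftrightarrow> 0 \<in> supp \<phi> \<and>
      (\<exists>n. (point_shift (extend_map f) \<phi> ^^ n) 0 = (point_shift (extend_map f) \<phi> ^^ n) y)"
    for \<phi> :: "'a measure" and y
  have supp0 [measurable]: "Measurable.pred (config_space \<Otimes>\<^sub>M borel) (\<lambda>a. 0 \<in> supp (fst a :: 'a measure))"
    by (rule measurable_in_supp) auto
  have P [measurable]: "Measurable.pred (config_space \<Otimes>\<^sub>M borel) (\<lambda>a. P (fst a) (snd a))"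
    unfolding P_def by measurable
  have eq: "emeasure (counting_measure (foil f \<phi> 0)) B
      = (\<integral>\<^sup>+y. (if P \<phi> y \<and> y \<in> B then 1 else 0) \<partial>\<phi>)" if \<phi>: "\<phi> \<in> space config_space" for \<phi>
  proof -
    have \<phi>': "\<phi> \<in> simple_counting_measures" using \<phi> by simp
    have "foil f \<phi> 0 = {y \<in> supp \<phi>. P \<phi> y}"
      unfolding foil_extend_map[OF f \<phi>', symmetric] by (auto simp: foil_def foil_rel_def P_def)
    moreover have "Measurable.pred borel (P \<phi>)"
      using measurable_compose[OF measurable_Pair1'[OF \<phi>] P] by simp
    ultimately show ?thesis
      by (simp add: emeasure_counting_measure_thinning[OF \<phi>'])
  qed
  show "(\<lambda>\<phi>. emeasure (counting_measure (foil f \<phi> 0)) B) \<in> borel_measurable config_space"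
    by (subst measurable_cong[OF eq], assumption, rule measurable_kernel_nn_integral)
      (auto simp: case_prod_beta')
qed

text \<open>Flow-adaptedness: a point-shift consults the configuration only as seen from the point being moved,
  so that it commutes with translations, and with it everything built from its iterates.\<close>

lemma point_shift_translate:
  assumes "\<phi> \<in> simple_counting_measures"
  shows "point_shift f (translate t \<phi>) x = point_shift f \<phi> (x + t) - t"
  by (simp add: point_shift_def translate_translate[OF assms])

lemma point_shift_funpow_translate:
  assumes "\<phi> \<in> simple_counting_measures"
  shows "(point_shift f (translate t \<phi>) ^^ n) x = (point_shift f \<phi> ^^ n) (x + t) - t"
  by (induction n) (simp_all add: point_shift_translate[OF assms])

lemma foil_translate:
  assumes "\<phi> \<in> simple_counting_measures"
  shows "foil f (translate t \<phi>) x = (\<lambda>y. y - t) ` foil f \<phi> (x + t)"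
proof -
  have mem: "y \<in> supp (translate t \<phi>) \<longleftrightarrow> y + t \<in> supp \<phi>" for y
    by (force simp: supp_translate[OF assms] image_iff)
  have "y \<in> foil f (translate t \<phi>) x \<longleftrightarrow> y + t \<in> foil f \<phi> (x + t)" for y
    by (simp add: foil_def foil_rel_def mem point_shift_funpow_translate[OF assms])
  then show ?thesis by (force simp: image_iff)
qed

lemma foil_refl: "x \<in> supp \<phi> \<Longrightarrow> x \<in> foil f \<phi> x"
  by (simp add: foil_def foil_rel_def)

text \<open>Transitivity of the foil relation: two coincidences at different times both persist to the sum of
  these times.\<close>

lemma foil_eqI:
  assumes "y \<in> foil f \<phi> x"
  shows "foil f \<phi> y = foil f \<phi> x"
proof -
  let ?F = "point_shift f \<phi>"
  have later: "(?F ^^ n) u = (?F ^^ n) v \<Longrightarrow> (?F ^^ (m + n)) u = (?F ^^ (m + n)) v" for m n u v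
    by (simp add: funpow_add)
  have trans: "\<exists>n. (?F ^^ n) u = (?F ^^ n) w"
    if "(?F ^^ n) u = (?F ^^ n) v" "(?F ^^ m) v = (?F ^^ m) w" for u v w m n
    using later[OF that(1), of m] later[OF that(2), of n] by (metis add.commute)
  from assms show ?thesis
    unfolding foil_def foil_rel_def by (auto intro: trans dest: sym)
qed

section \<open>Invariance of sums under bijective point-shifts\<close>

lemma nn_integral_simple_counting_measure_swap:
  fixes \<phi> :: "'a::euclidean_space measure"
  assumes \<phi>: "\<phi> \<in> simple_counting_measures"
    and L: "sigma_finite_measure L"
    and u [measurable]: "(\<lambda>(x, s). u x s) \<in> borel_measurable (borel \<Otimes>\<^sub>M L)"
  shows "(\<integral>\<^sup>+x. (\<integral>\<^sup>+s. u x s \<partial>L) \<partial>\<phi>) = (\<integral>\<^sup>+s. (\<integral>\<^sup>+x. u x s \<partial>\<phi>) \<partial>L)"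
proof -
  interpret L: sigma_finite_measure L by (rule L)
  have [measurable]: "u x \<in> borel_measurable L" for x by measurable
  have "(\<integral>\<^sup>+x. (\<integral>\<^sup>+s. u x s \<partial>L) \<partial>\<phi>) = (\<integral>\<^sup>+x. (\<integral>\<^sup>+s. u x s \<partial>L) \<partial>count_space (supp \<phi>))"
    by (rule nn_integral_simple_counting_measure[OF \<phi>]) measurable
  also have "\<dots> = (\<integral>\<^sup>+s. (\<integral>\<^sup>+x. u x s \<partial>count_space (supp \<phi>)) \<partial>L)"
    by (rule nn_integral_count_space_nn_integral[symmetric])
      (auto intro: locally_finite_set_countable simple_counting_measuresE(2)[OF \<phi>])
  also have "\<dots> = (\<integral>\<^sup>+s. (\<integral>\<^sup>+x. u x s \<partial>\<phi>) \<partial>L)"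
    by (intro nn_integral_cong nn_integral_simple_counting_measure[OF \<phi>, symmetric]) measurable
  finally show ?thesis .
qed

lemma nn_integral_lborel_indicator_shift:
  fixes C :: "'a::euclidean_space set"
  assumes [measurable]: "C \<in> sets borel"
  shows "(\<integral>\<^sup>+s. indicator C (x + s) \<partial>lborel) = emeasure lborel C"
    and "(\<integral>\<^sup>+s. indicator C (x - s) \<partial>lborel) = emeasure lborel C"
proof -
  have "(\<integral>\<^sup>+s. indicator C (x + c *\<^sub>R s) \<partial>lborel) = emeasure lborel C" if "\<bar>c\<bar> = 1" for c :: real
  proof -
    have "lborel = distr lborel borel (\<lambda>s. x + c *\<^sub>R s)"
      using lborel_affine[of c x] that by (simp add: density_1)
    then have "emeasure lborel C = (\<integral>\<^sup>+y. indicator C y \<partial>distr lborel borel (\<lambda>s. x + c *\<^sub>R s))"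
      by (metis assms nn_integral_indicator sets_lborel)
    also have "\<dots> = (\<integral>\<^sup>+s. indicator C (x + c *\<^sub>R s) \<partial>lborel)"
      by (intro nn_integral_distr) measurable
    finally show ?thesis ..
  qed
  from this[of 1] this[of "-1"] show "(\<integral>\<^sup>+s. indicator C (x + s) \<partial>lborel) = emeasure lborel C"
    and "(\<integral>\<^sup>+s. indicator C (x - s) \<partial>lborel) = emeasure lborel C"
    by simp_all
qed

locale stationary_process =
  fixes M :: "'w measure"
    and \<theta> :: "'a::euclidean_space \<Rightarrow> 'w \<Rightarrow> 'w"
    and \<Phi> :: "'w \<Rightarrow> 'a measure"
  assumes stationary: "stationary_point_process M \<theta> \<Phi>"
begin

sublocale prob_space M
  using stationary by (simp add: stationary_point_process_def)

lemma measurable_config [measurable]: "\<Phi> \<in> M \<rightarrow>\<^sub>M config_space"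
  using stationary by (simp add: stationary_point_process_def)

lemma measurable_flow' [measurable]:
  assumes "g \<in> N \<rightarrow>\<^sub>M borel" "k \<in> N \<rightarrow>\<^sub>M M"
  shows "(\<lambda>a. \<theta> (g a) (k a)) \<in> N \<rightarrow>\<^sub>M M"
proof -
  have "(\<lambda>(t, \<omega>). \<theta> t \<omega>) \<in> borel \<Otimes>\<^sub>M M \<rightarrow>\<^sub>M M"
    using stationary by (simp add: stationary_point_process_def measurable_flow_def)
  from measurable_compose[OF measurable_Pair[OF assms] this] show ?thesis by simp
qed

lemma flow_in_space [simp]: "\<omega> \<in> space M \<Longrightarrow> \<theta> t \<omega> \<in> space M"
  using measurable_space[OF measurable_flow'[of "\<lambda>_. t" M "\<lambda>\<omega>. \<omega>"]] by simp

lemma flow_add: "\<omega> \<in> space M \<Longrightarrow> \<theta> s (\<theta> t \<omega>) = \<theta> (s + t) \<omega>"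
  using stationary by (simp add: stationary_point_process_def measurable_flow_def)

lemma config_simple: "\<omega> \<in> space M \<Longrightarrow> \<Phi> \<omega> \<in> simple_counting_measures"
  using measurable_space[OF measurable_config] by simp

lemma config_flow: "\<omega> \<in> space M \<Longrightarrow> \<Phi> (\<theta> t \<omega>) = translate t (\<Phi> \<omega>)"
  using stationary by (simp add: stationary_point_process_def)

lemma nn_integral_flow:
  assumes "u \<in> borel_measurable M"
  shows "(\<integral>\<^sup>+\<omega>. u (\<theta> t \<omega>) \<partial>M) = (\<integral>\<^sup>+\<omega>. u \<omega> \<partial>M)"
proof -
  have "(\<integral>\<^sup>+\<omega>. u \<omega> \<partial>M) = (\<integral>\<^sup>+\<omega>. u \<omega> \<partial>distr M M (\<theta> t))"
    using stationary by (simp add: stationary_point_process_def)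
  also have "\<dots> = (\<integral>\<^sup>+\<omega>. u (\<theta> t \<omega>) \<partial>M)"
    using assms by (intro nn_integral_distr) measurable
  finally show ?thesis ..
qed

lemma measurable_sum_over_config [measurable (raw)]:
  assumes "k \<in> N \<rightarrow>\<^sub>M M" "(\<lambda>(a, x). u a x) \<in> borel_measurable (N \<Otimes>\<^sub>M borel)"
  shows "(\<lambda>a. \<integral>\<^sup>+x. u a x \<partial>\<Phi> (k a)) \<in> borel_measurable N"
  by (rule measurable_kernel_nn_integral[OF measurable_compose[OF assms(1) measurable_config] assms(2)])

lemma nn_integral_config:
  assumes "\<omega> \<in> space M" "u \<in> borel_measurable borel"
  shows "(\<integral>\<^sup>+x. u x \<partial>\<Phi> \<omega>) = (\<integral>\<^sup>+x. u x \<partial>count_space (supp (\<Phi> \<omega>)))"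
  by (rule nn_integral_simple_counting_measure[OF config_simple[OF assms(1)] assms(2)])

text \<open>Up to the factor given by the intensity, this is the invariance of the Palm probability under
  \<open>\<omega> \<mapsto> \<theta>\<^bsub>h(\<Phi>(\<omega>))\<^esub> \<omega>\<close>. With \<open>H\<close> the point-shift, the calculation below is
  \<open>E \<Sum>\<^sub>x 1\<^sub>C(x) g(\<theta>\<^bsub>H(x)\<^esub> \<omega>)\<close>
  \<open>= \<integral> E \<Sum>\<^sub>x 1\<^sub>C(x) 1\<^sub>C(H(x) - s) g(\<theta>\<^bsub>H(x)\<^esub> \<omega>) ds\<close>
  \<open>= \<integral> E \<Sum>\<^sub>x 1\<^sub>C(x + s) 1\<^sub>C(H(x)) g(\<theta>\<^bsub>H(x)\<^esub> \<omega>) ds\<close>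
  \<open>= E \<Sum>\<^sub>x 1\<^sub>C(H(x)) g(\<theta>\<^bsub>H(x)\<^esub> \<omega>)\<close>
  \<open>= E \<Sum>\<^sub>x 1\<^sub>C(x) g(\<theta>\<^sub>x \<omega>)\<close>:
  the first and the third equality use that \<open>C\<close> has volume one, the second is
  stationarity under \<open>\<theta>\<^bsub>-s\<^esub>\<close>, and the last one is bijectivity of \<open>H\<close> on the points.\<close>

lemma sum_bijective_point_shift:
  fixes C :: "'a set"
  assumes C [measurable]: "C \<in> sets borel" and C1: "emeasure lborel C = 1"
    and h: "point_map h" and g [measurable]: "g \<in> borel_measurable M"
    and bij: "AE \<omega> in M. bij_betw (point_shift h (\<Phi> \<omega>)) (supp (\<Phi> \<omega>)) (supp (\<Phi> \<omega>))"
  shows "(\<integral>\<^sup>+\<omega>. (\<integral>\<^sup>+x. indicator C x * g (\<theta> (point_shift (extend_map h) (\<Phi> \<omega>) x) \<omega>) \<partial>\<Phi> \<omega>) \<partial>M)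
    = (\<integral>\<^sup>+\<omega>. (\<integral>\<^sup>+x. indicator C x * g (\<theta> x \<omega>) \<partial>\<Phi> \<omega>) \<partial>M)"
proof -
  define H where "H \<omega> = point_shift (extend_map h) (\<Phi> \<omega>)" for \<omega>
  have H [measurable (raw)]: "(\<lambda>a. H (k a) (v a)) \<in> N \<rightarrow>\<^sub>M borel"
    if "k \<in> N \<rightarrow>\<^sub>M M" "v \<in> N \<rightarrow>\<^sub>M borel" for k v and N :: "'n measure"
    unfolding H_def
    by (rule measurable_point_shift[OF measurable_extend_map[OF h] measurable_compose[OF that(1) measurable_config] that(2)])
  have H_flow: "H (\<theta> t \<omega>) (x - t) = H \<omega> x - t" if "\<omega> \<in> space M" for \<omega> t x
    using that by (simp add: H_def config_flow point_shift_translate config_simple)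
  \<comment> \<open>\<open>J\<close> and \<open>J'\<close> differ by moving the whole picture by \<open>s\<close>, so they have the same mean.\<close>
  define J where "J s \<omega> = (\<integral>\<^sup>+x. indicator C x * indicator C (H \<omega> x - s) * g (\<theta> (H \<omega> x) \<omega>) \<partial>\<Phi> \<omega>)"
    for s \<omega>
  define J' where "J' s \<omega> = (\<integral>\<^sup>+x. indicator C (x + s) * indicator C (H \<omega> x) * g (\<theta> (H \<omega> x) \<omega>) \<partial>\<Phi> \<omega>)"
    for s \<omega>
  have [measurable]: "(\<lambda>(\<omega>, s). J s \<omega>) \<in> borel_measurable (M \<Otimes>\<^sub>M lborel)"
    "(\<lambda>(\<omega>, s). J' s \<omega>) \<in> borel_measurable (M \<Otimes>\<^sub>M lborel)"
    unfolding J_def J'_def by measurable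
  interpret pair_sigma_finite M lborel ..
  have swap: "(\<integral>\<^sup>+x. (\<integral>\<^sup>+s. u x s \<partial>lborel) \<partial>\<Phi> \<omega>) = (\<integral>\<^sup>+s. (\<integral>\<^sup>+x. u x s \<partial>\<Phi> \<omega>) \<partial>lborel)"
    if "\<omega> \<in> space M" "(\<lambda>(x, s). u x s) \<in> borel_measurable (borel \<Otimes>\<^sub>M borel)"
    for u :: "'a \<Rightarrow> 'a \<Rightarrow> ennreal" and \<omega>
    using that by (intro nn_integral_simple_counting_measure_swap)
      (auto simp: config_simple sigma_finite_lborel cong: measurable_cong_sets)
  have J_shift: "J s (\<theta> (- s) \<omega>) = J' s \<omega>" if \<omega>: "\<omega> \<in> space M" for s \<omega>
  proof -
    have \<omega>s [measurable]: "\<theta> (- s) \<omega> \<in> space M" using \<omega> by (rule flow_in_space)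
    have m: "(\<lambda>x. indicator C x * indicator C (H (\<theta> (- s) \<omega>) x - s)
        * g (\<theta> (H (\<theta> (- s) \<omega>) x) (\<theta> (- s) \<omega>))) \<in> borel_measurable borel"
      by measurable
    \<comment> \<open>The points of \<open>\<Phi> (\<theta> (- s) \<omega>)\<close> are the \<open>x + s\<close> with \<open>x\<close> a point of \<open>\<Phi> \<omega>\<close>; writing them
      \<open>x - - s\<close> fits the equivariance of \<open>H\<close>.\<close>
    have "J s (\<theta> (- s) \<omega>) = (\<integral>\<^sup>+x. indicator C (x - - s)
        * indicator C (H (\<theta> (- s) \<omega>) (x - - s) - s)
        * g (\<theta> (H (\<theta> (- s) \<omega>) (x - - s)) (\<theta> (- s) \<omega>)) \<partial>\<Phi> \<omega>)"
      unfolding J_def config_flow[OF \<omega>]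
      by (rule nn_integral_translate[OF config_simple[OF \<omega>] m])
    also have "\<dots> = J' s \<omega>"
      unfolding J'_def H_flow[OF \<omega>] by (simp add: flow_add[OF \<omega>])
    finally show ?thesis .
  qed
  have "(\<integral>\<^sup>+\<omega>. (\<integral>\<^sup>+x. indicator C x * g (\<theta> (H \<omega> x) \<omega>) \<partial>\<Phi> \<omega>) \<partial>M)
      = (\<integral>\<^sup>+\<omega>. (\<integral>\<^sup>+s. J s \<omega> \<partial>lborel) \<partial>M)"
  proof (rule nn_integral_cong)
    fix \<omega> assume \<omega> [measurable]: "\<omega> \<in> space M"
    have "(\<integral>\<^sup>+s. J s \<omega> \<partial>lborel) = (\<integral>\<^sup>+x. (\<integral>\<^sup>+s. indicator C x * indicator C (H \<omega> x - s)
        * g (\<theta> (H \<omega> x) \<omega>) \<partial>lborel) \<partial>\<Phi> \<omega>)"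
      unfolding J_def by (rule swap[OF \<omega>, symmetric]) measurable
    also have "\<dots> = (\<integral>\<^sup>+x. indicator C x * g (\<theta> (H \<omega> x) \<omega>) \<partial>\<Phi> \<omega>)"
      by (simp add: nn_integral_cmult nn_integral_multc nn_integral_lborel_indicator_shift C1)
    finally show "(\<integral>\<^sup>+x. indicator C x * g (\<theta> (H \<omega> x) \<omega>) \<partial>\<Phi> \<omega>) = (\<integral>\<^sup>+s. J s \<omega> \<partial>lborel)" ..
  qed
  also have "\<dots> = (\<integral>\<^sup>+s. (\<integral>\<^sup>+\<omega>. J s \<omega> \<partial>M) \<partial>lborel)"
    by (rule Fubini'[symmetric]) measurable
  also have "\<dots> = (\<integral>\<^sup>+s. (\<integral>\<^sup>+\<omega>. J' s \<omega> \<partial>M) \<partial>lborel)"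
  proof (rule nn_integral_cong)
    fix s :: 'a
    have "(\<integral>\<^sup>+\<omega>. J s \<omega> \<partial>M) = (\<integral>\<^sup>+\<omega>. J s (\<theta> (- s) \<omega>) \<partial>M)"
      by (rule nn_integral_flow[symmetric]) measurable
    also have "\<dots> = (\<integral>\<^sup>+\<omega>. J' s \<omega> \<partial>M)"
      by (intro nn_integral_cong J_shift)
    finally show "(\<integral>\<^sup>+\<omega>. J s \<omega> \<partial>M) = (\<integral>\<^sup>+\<omega>. J' s \<omega> \<partial>M)" .
  qed
  also have "\<dots> = (\<integral>\<^sup>+\<omega>. (\<integral>\<^sup>+s. J' s \<omega> \<partial>lborel) \<partial>M)"
    by (rule Fubini') measurable
  also have "\<dots> = (\<integral>\<^sup>+\<omega>. (\<integral>\<^sup>+x. indicator C (H \<omega> x) * g (\<theta> (H \<omega> x) \<omega>) \<partial>\<Phi> \<omega>) \<partial>M)"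
  proof (rule nn_integral_cong)
    fix \<omega> assume \<omega> [measurable]: "\<omega> \<in> space M"
    have "(\<integral>\<^sup>+s. J' s \<omega> \<partial>lborel) = (\<integral>\<^sup>+x. (\<integral>\<^sup>+s. indicator C (x + s) * indicator C (H \<omega> x)
        * g (\<theta> (H \<omega> x) \<omega>) \<partial>lborel) \<partial>\<Phi> \<omega>)"
      unfolding J'_def by (rule swap[OF \<omega>, symmetric]) measurable
    also have "\<dots> = (\<integral>\<^sup>+x. indicator C (H \<omega> x) * g (\<theta> (H \<omega> x) \<omega>) \<partial>\<Phi> \<omega>)"
      by (simp add: nn_integral_cmult nn_integral_multc nn_integral_lborel_indicator_shift C1)
    finally show "(\<integral>\<^sup>+s. J' s \<omega> \<partial>lborel)
      = (\<integral>\<^sup>+x. indicator C (H \<omega> x) * g (\<theta> (H \<omega> x) \<omega>) \<partial>\<Phi> \<omega>)" .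
  qed
  also have "\<dots> = (\<integral>\<^sup>+\<omega>. (\<integral>\<^sup>+x. indicator C x * g (\<theta> x \<omega>) \<partial>\<Phi> \<omega>) \<partial>M)"
  proof (rule nn_integral_cong_AE)
    show "AE \<omega> in M. (\<integral>\<^sup>+x. indicator C (H \<omega> x) * g (\<theta> (H \<omega> x) \<omega>) \<partial>\<Phi> \<omega>)
        = (\<integral>\<^sup>+x. indicator C x * g (\<theta> x \<omega>) \<partial>\<Phi> \<omega>)"
      using bij AE_space
    proof eventually_elim
      case (elim \<omega>)
      note \<omega> [measurable] = elim(2)
      have bij: "bij_betw (H \<omega>) (supp (\<Phi> \<omega>)) (supp (\<Phi> \<omega>))"
        using elim(1) unfolding H_def
        by (subst bij_betw_cong[OF point_shift_extend_map[OF config_simple[OF \<omega>]]])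
      have "(\<integral>\<^sup>+x. indicator C (H \<omega> x) * g (\<theta> (H \<omega> x) \<omega>) \<partial>\<Phi> \<omega>)
          = (\<integral>\<^sup>+x. indicator C (H \<omega> x) * g (\<theta> (H \<omega> x) \<omega>) \<partial>count_space (supp (\<Phi> \<omega>)))"
        by (rule nn_integral_config[OF \<omega>]) measurable
      also have "\<dots> = (\<integral>\<^sup>+x. indicator C x * g (\<theta> x \<omega>) \<partial>count_space (supp (\<Phi> \<omega>)))"
        by (rule nn_integral_bij_count_space[OF bij])
      also have "\<dots> = (\<integral>\<^sup>+x. indicator C x * g (\<theta> x \<omega>) \<partial>\<Phi> \<omega>)"
        by (rule nn_integral_config[OF \<omega>, symmetric]) measurable
      finally show ?case .
    qed
  qed
  finally show ?thesis by (simp add: H_def)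
qed

section \<open>Palm distribution of the point foil\<close>

lemma space_palm [simp]: "space (palm M \<theta> \<Phi>) = space M"
  and sets_palm [simp, measurable_cong]: "sets (palm M \<theta> \<Phi>) = sets M"
  by (simp_all add: palm_def sets.space_closed sets.sigma_sets_eq)

lemma emeasure_palm:
  assumes A: "A \<in> sets M"
  shows "emeasure (palm M \<theta> \<Phi>) A
    = (\<integral>\<^sup>+\<omega>. (\<integral>\<^sup>+x. indicator (cbox 0 One) x * indicator A (\<theta> x \<omega>) \<partial>\<Phi> \<omega>) \<partial>M) / intensity M \<Phi>"
proof -
  let ?C = "cbox 0 One :: 'a set"
  define \<mu> where "\<mu> A = (\<integral>\<^sup>+\<omega>. (\<integral>\<^sup>+x\<in>?C. indicator A (\<theta> x \<omega>) \<partial>\<Phi> \<omega>) \<partial>M) / intensity M \<Phi>" for A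
  have "emeasure (palm M \<theta> \<Phi>) A = \<mu> A"
  proof (rule emeasure_measure_of)
    show "palm M \<theta> \<Phi> = measure_of (space M) (sets M) \<mu>"
      unfolding palm_def \<mu>_def ..
    show "positive (sets (palm M \<theta> \<Phi>)) \<mu>"
      by (simp add: positive_def \<mu>_def)
    show "countably_additive (sets (palm M \<theta> \<Phi>)) \<mu>"
      unfolding countably_additive_def sets_palm
    proof (intro allI impI)
      fix A :: "nat \<Rightarrow> 'w set"
      assume A: "range A \<subseteq> sets M" "disjoint_family A"
      then have [measurable]: "A i \<in> sets M" for i by auto
      have "(\<integral>\<^sup>+\<omega>. (\<integral>\<^sup>+x\<in>?C. indicator (\<Union>i. A i) (\<theta> x \<omega>) \<partial>\<Phi> \<omega>) \<partial>M)
          = (\<integral>\<^sup>+\<omega>. (\<Sum>i. \<integral>\<^sup>+x\<in>?C. indicator (A i) (\<theta> x \<omega>) \<partial>\<Phi> \<omega>) \<partial>M)"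
      proof (rule nn_integral_cong)
        fix \<omega> assume \<omega> [measurable]: "\<omega> \<in> space M"
        have [measurable_cong]: "sets (\<Phi> \<omega>) = sets borel"
          by (rule simple_counting_measures_sets[OF config_simple[OF \<omega>]])
        have "(\<Sum>i. \<integral>\<^sup>+x\<in>?C. indicator (A i) (\<theta> x \<omega>) \<partial>\<Phi> \<omega>)
            = (\<integral>\<^sup>+x. (\<Sum>i. indicator (A i) (\<theta> x \<omega>) * indicator ?C x) \<partial>\<Phi> \<omega>)"
          by (rule nn_integral_suminf[symmetric]) measurable
        then show "(\<integral>\<^sup>+x\<in>?C. indicator (\<Union>i. A i) (\<theta> x \<omega>) \<partial>\<Phi> \<omega>)
          = (\<Sum>i. \<integral>\<^sup>+x\<in>?C. indicator (A i) (\<theta> x \<omega>) \<partial>\<Phi> \<omega>)"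
          by (simp add: suminf_indicator[OF A(2), symmetric])
      qed
      also have "\<dots> = (\<Sum>i. \<integral>\<^sup>+\<omega>. (\<integral>\<^sup>+x\<in>?C. indicator (A i) (\<theta> x \<omega>) \<partial>\<Phi> \<omega>) \<partial>M)"
        by (rule nn_integral_suminf) measurable
      finally show "(\<Sum>i. \<mu> (A i)) = \<mu> (\<Union>i. A i)"
        by (simp add: \<mu>_def divide_ennreal_def)
    qed
  qed (use A sets.space_closed in auto)
  then show ?thesis by (simp add: \<mu>_def mult.commute)
qed

lemma measurable_point_foil:
  assumes "point_map f"
  shows "point_foil f \<Phi> \<in> M \<rightarrow>\<^sub>M config_space"
  unfolding point_foil_def[abs_def]
  by (rule measurable_compose[OF measurable_config measurable_foil_at_zero[OF assms]])

lemma point_foil_flow: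
  assumes "\<omega> \<in> space M"
  shows "point_foil f \<Phi> (\<theta> x \<omega>) = translate x (counting_measure (foil f (\<Phi> \<omega>) x))"
  by (simp add: point_foil_def config_flow foil_translate config_simple assms translate_counting_measure)

text \<open>Outside \<open>\<^bold>N\<^sup>0\<close> the value of \<open>h\<close> is arbitrary, but there the point foil is the zero measure and its
  translations do not depend on the shift.\<close>

lemma translate_point_foil_extend_map:
  assumes "\<omega> \<in> space M"
  shows "translate (h (\<Phi> \<omega>)) (point_foil f \<Phi> \<omega>) = translate (extend_map h (\<Phi> \<omega>)) (point_foil f \<Phi> \<omega>)"
proof (cases "0 \<in> supp (\<Phi> \<omega>)")
  case False
  then have "foil f (\<Phi> \<omega>) 0 = {}" by (simp add: foil_def foil_rel_def)
  then show ?thesis by (simp add: point_foil_def translate_counting_measure)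
qed (simp add: extend_map_def)

lemma measurable_translate_point_foil:
  assumes "point_map f" "point_map h"
  shows "(\<lambda>\<omega>. translate (h (\<Phi> \<omega>)) (point_foil f \<Phi> \<omega>)) \<in> M \<rightarrow>\<^sub>M config_space"
  by (subst measurable_cong[OF translate_point_foil_extend_map], assumption)
    (rule measurable_translate[OF measurable_point_foil[OF assms(1)]
      measurable_compose[OF measurable_config measurable_extend_map[OF assms(2)]]])

text \<open>Both sides are the common foil of \<open>x\<close> and its image, centred at the image.\<close>

lemma translate_point_foil_along_shift:
  assumes \<omega>: "\<omega> \<in> space M" and x: "x \<in> supp (\<Phi> \<omega>)"
    and inv: "point_shift h (\<Phi> \<omega>) ` foil f (\<Phi> \<omega>) x = foil f (\<Phi> \<omega>) x"
  shows "translate (h (\<Phi> (\<theta> x \<omega>))) (point_foil f \<Phi> (\<theta> x \<omega>))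
    = point_foil f \<Phi> (\<theta> (point_shift h (\<Phi> \<omega>) x) \<omega>)"
proof -
  have "point_shift h (\<Phi> \<omega>) x \<in> foil f (\<Phi> \<omega>) x"
    using foil_refl[OF x, of f] inv by auto
  note foil_eq = foil_eqI[OF this]
  have "locally_finite_set (foil f (\<Phi> \<omega>) x)"
    using locally_finite_subset[OF simple_counting_measuresE(2)[OF config_simple[OF \<omega>]] foil_subset_supp] .
  from translate_translate[OF counting_measure_in_simple[OF this]] show ?thesis
    by (simp add: point_foil_flow[OF \<omega>] foil_eq config_flow[OF \<omega>])
      (simp add: point_shift_def)
qed

text \<open>Palm probabilities are written as sums over the points of \<open>\<Phi>\<close> in the unit cube. There the translated foil is
  the foil seen from the image point, and the invariance of such sums under a bijective point-shift applies
  to the indicator of the event that the point foil lies in \<open>A\<close>.\<close>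

lemma distr_palm_point_foil:
  assumes f: "point_map f" and h: "point_map h"
    and bij: "AE \<omega> in M. bij_betw (point_shift h (\<Phi> \<omega>)) (supp (\<Phi> \<omega>)) (supp (\<Phi> \<omega>))"
    and inv: "AE \<omega> in M. \<forall>x\<in>supp (\<Phi> \<omega>).
      point_shift h (\<Phi> \<omega>) ` foil f (\<Phi> \<omega>) x = foil f (\<Phi> \<omega>) x"
  shows "distr (palm M \<theta> \<Phi>) config_space (\<lambda>\<omega>. translate (h (\<Phi> \<omega>)) (point_foil f \<Phi> \<omega>))
    = distr (palm M \<theta> \<Phi>) config_space (point_foil f \<Phi>)"
proof -
  let ?C = "cbox 0 One :: 'a set"
  let ?P = "palm M \<theta> \<Phi>"
  define T where "T \<omega> = translate (h (\<Phi> \<omega>)) (point_foil f \<Phi> \<omega>)" for \<omega>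
  have T [measurable]: "T \<in> M \<rightarrow>\<^sub>M config_space"
    unfolding T_def[abs_def] by (rule measurable_translate_point_foil[OF f h])
  note foil [measurable] = measurable_point_foil[OF f]
  have pull: "emeasure (distr ?P config_space X) A = (\<integral>\<^sup>+\<omega>. (\<integral>\<^sup>+x. indicator ?C x
      * indicator A (X (\<theta> x \<omega>)) \<partial>\<Phi> \<omega>) \<partial>M) / intensity M \<Phi>"
    if X [measurable]: "X \<in> M \<rightarrow>\<^sub>M config_space" and A [measurable]: "A \<in> sets config_space" for X A
  proof -
    have "emeasure (distr ?P config_space X) A = emeasure ?P (X -` A \<inter> space M)"
      by (subst emeasure_distr) auto
    also have "\<dots> = (\<integral>\<^sup>+\<omega>. (\<integral>\<^sup>+x. indicator ?C x * indicator A (X (\<theta> x \<omega>)) \<partial>\<Phi> \<omega>) \<partial>M)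
        / intensity M \<Phi>"
      by (subst emeasure_palm)
        (auto intro!: arg_cong2[where f = "(/)"] nn_integral_cong simp: indicator_def)
    finally show ?thesis .
  qed
  have "distr ?P config_space T = distr ?P config_space (point_foil f \<Phi>)"
  proof (rule measure_eqI)
    fix A assume "A \<in> sets (distr ?P config_space T)"
    then have A [measurable]: "A \<in> sets config_space" by simp
    let ?g = "\<lambda>\<omega>. indicator A (point_foil f \<Phi> \<omega>) :: ennreal"
    have g: "?g \<in> borel_measurable M" by measurable
    have C1: "emeasure lborel ?C = 1" by (simp add: emeasure_lborel_cbox_eq)
    have "(\<integral>\<^sup>+\<omega>. (\<integral>\<^sup>+x. indicator ?C x * indicator A (T (\<theta> x \<omega>)) \<partial>\<Phi> \<omega>) \<partial>M)
        = (\<integral>\<^sup>+\<omega>. (\<integral>\<^sup>+x. indicator ?C x * ?g (\<theta> (point_shift (extend_map h) (\<Phi> \<omega>) x) \<omega>) \<partial>\<Phi> \<omega>) \<partial>M)"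
    proof (rule nn_integral_cong_AE)
      show "AE \<omega> in M. (\<integral>\<^sup>+x. indicator ?C x * indicator A (T (\<theta> x \<omega>)) \<partial>\<Phi> \<omega>)
        = (\<integral>\<^sup>+x. indicator ?C x * ?g (\<theta> (point_shift (extend_map h) (\<Phi> \<omega>) x) \<omega>) \<partial>\<Phi> \<omega>)"
        using inv AE_space
      proof eventually_elim
        case (elim \<omega>)
        note \<omega> [measurable] = elim(2)
        note [measurable] = measurable_point_shift[OF measurable_extend_map[OF h], of "\<lambda>_. \<Phi> \<omega>" borel]
        have [measurable]: "\<Phi> \<omega> \<in> space config_space" using config_simple[OF \<omega>] by simp
        have "(\<integral>\<^sup>+x. indicator ?C x * indicator A (T (\<theta> x \<omega>)) \<partial>\<Phi> \<omega>)
            = (\<integral>\<^sup>+x. indicator ?C x * indicator A (T (\<theta> x \<omega>)) \<partial>count_space (supp (\<Phi> \<omega>)))"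
          by (rule nn_integral_config[OF \<omega>]) measurable
        also have "\<dots> = (\<integral>\<^sup>+x. indicator ?C x * ?g (\<theta> (point_shift (extend_map h) (\<Phi> \<omega>) x) \<omega>)
            \<partial>count_space (supp (\<Phi> \<omega>)))"
          using elim(1)
          by (intro nn_integral_cong) (simp add: T_def translate_point_foil_along_shift[OF \<omega>]
              point_shift_extend_map[OF config_simple[OF \<omega>]])
        also have "\<dots> = (\<integral>\<^sup>+x. indicator ?C x * ?g (\<theta> (point_shift (extend_map h) (\<Phi> \<omega>) x) \<omega>) \<partial>\<Phi> \<omega>)"
          by (rule nn_integral_config[OF \<omega>, symmetric]) measurable
        finally show ?case .
      qed
    qed
    also have "\<dots> = (\<integral>\<^sup>+\<omega>. (\<integral>\<^sup>+x. indicator ?C x * ?g (\<theta> x \<omega>) \<partial>\<Phi> \<omega>) \<partial>M)"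
      by (rule sum_bijective_point_shift[OF _ C1 h g bij]) simp
    finally show "emeasure (distr ?P config_space T) A
        = emeasure (distr ?P config_space (point_foil f \<Phi>)) A"
      by (simp add: pull)
  qed simp
  then show ?thesis by (simp add: T_def[abs_def])
qed

end

theorem mainTheorem4:
  fixes M :: "'w measure"
    and \<theta> :: "'a::euclidean_space \<Rightarrow> 'w \<Rightarrow> 'w"
    and \<Phi> :: "'w \<Rightarrow> 'a measure"
    and f h :: "'a measure \<Rightarrow> 'a"
  assumes "stationary_point_process M \<theta> \<Phi>"
    and "0 < intensity M \<Phi>" and "intensity M \<Phi> < \<infinity>"
    and "point_map f" and "point_map h"
    and "AE \<omega> in M.
      bij_betw (point_shift h (\<Phi> \<omega>)) (supp (\<Phi> \<omega>)) (supp (\<Phi> \<omega>)) \<and>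
      (\<forall>x\<in>supp (\<Phi> \<omega>). point_shift h (\<Phi> \<omega>) ` foil f (\<Phi> \<omega>) x = foil f (\<Phi> \<omega>) x)"
  shows "point_foil f \<Phi> \<in> palm M \<theta> \<Phi> \<rightarrow>\<^sub>M config_space \<and>
    (\<lambda>\<omega>. translate (h (\<Phi> \<omega>)) (point_foil f \<Phi> \<omega>)) \<in> palm M \<theta> \<Phi> \<rightarrow>\<^sub>M config_space \<and>
    distr (palm M \<theta> \<Phi>) config_space (\<lambda>\<omega>. translate (h (\<Phi> \<omega>)) (point_foil f \<Phi> \<omega>)) =
    distr (palm M \<theta> \<Phi>) config_space (point_foil f \<Phi>)"
proof -
  interpret stationary_process M \<theta> \<Phi> by standard (rule assms(1))
  have bij: "AE \<omega> in M. bij_betw (point_shift h (\<Phi> \<omega>)) (supp (\<Phi> \<omega>)) (supp (\<Phi> \<omega>))"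
    and inv: "AE \<omega> in M. \<forall>x\<in>supp (\<Phi> \<omega>). point_shift h (\<Phi> \<omega>) ` foil f (\<Phi> \<omega>) x = foil f (\<Phi> \<omega>) x"
    using assms(6) by auto
  show ?thesis
    using measurable_point_foil[OF assms(4)] measurable_translate_point_foil[OF assms(4,5)]
      distr_palm_point_foil[OF assms(4,5) bij inv]
    by (simp add: measurable_cong_sets[OF sets_palm refl])
qed

end
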